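(* Let $p$ be a prime and let $x$ and $y$ be $p$-adic integers with $y\not\equiv 0\pmod p$. (i) We have $$\sum_{k=0}^{p-1}D_k(x,y)D_k(-1-x,y)\equiv(-1)^{\langle x\rangle_p}\pmod p.$$ If moreover $y\not\equiv 1\pmod p$, then $$\sum_{k=0}^{p-1}(1-y)^kD_k(x,y)D_k\left(x,\frac y{y-1}\right)\equiv(-1)^{\langle x\rangle_p}\pmod p.$$ (ii) Provided $p\neq 2$, we have $$\sum_{k=0}^{p-1}S_k(x,y)^2\equiv\begin{cases}\left(\frac{-1}{p}\right)\pmod p&\text{if } x\equiv-1/2\pmod p,\\ 0\pmod p&\text{otherwise}.\end{cases}$$
   Context: For $n\in\{0,1,2,\ldots\}$ and a variable $x$, $\binom{x}{k}=x(x-1)\cdots(x-k+1)/k!$. Define the polynomials $$D_n(x,y)=\sum_{k=0}^n\binom nk\binom xk y^k,\qquad S_n(x,y)=\sum_{k=0}^n\binom nk\binom xk\binom{-1-x}{k}y^k.$$ For a $p$-adic integer $x$, $\langle x\rangle_p$ denotes the least nonnegative integer $r$ with $x\equiv r\pmod p$. For $p$-adic numbers $a,b$, $a\equiv b\pmod{p^m}$ means $(a-b)/p^m$ is a $p$-adic integer. $\left(\frac{\cdot}{p}\right)$ is the Legendre symbol. *)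

theory Defs
  imports
    "HOL-Computational_Algebra.Polynomial_Factorial"
    "HOL-Number_Theory.Number_Theory"
    "Berlekamp_Zassenhaus.Finite_Field"
begin

text \<open>
  The prime \<open>p\<close> is the cardinality of a type of class \<^class>\<open>prime_card\<close>, so that the
  \<open>p\<close>-adic integers and the \<open>p\<close>-adic numbers are types.  The \<open>p\<close>-adic integers are the inverse
  limit of the rings of integers modulo \<open>p ^ n\<close>: the \<open>n\<close>-th entry of a coherent sequence is the
  representative in \<open>{0..<p ^ n}\<close> of the residue class modulo \<open>p ^ n\<close>.
\<close>

typedef (overloaded) ('p::prime_card) padic_int =
  "{f :: nat \<Rightarrow> int. \<forall>n. f n \<in> {0..<int CARD('p) ^ n} \<and>
                         f (Suc n) mod int CARD('p) ^ n = f n}"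
  morphisms padic_residue Abs_padic_int
  by (rule exI[of _ "\<lambda>_. 0"]) (use prime_card[where 'a = 'p] prime_gt_0_nat in auto)

setup_lifting type_definition_padic_int

lemma prime_card_power_pos: "0 < int CARD('p::prime_card) ^ n"
  using prime_gt_0_nat[OF prime_card[where 'a = 'p]] by simp

lemma mod_power_Suc_mod: "a mod (q::int) ^ Suc n mod q ^ n = a mod q ^ n"
  by (rule mod_mod_cancel) simp

instantiation padic_int :: (prime_card) comm_ring_1
begin

lift_definition zero_padic_int :: "'a padic_int" is "\<lambda>_. 0"
  by (simp add: prime_card_power_pos[where 'p = 'a, simplified])

lift_definition one_padic_int :: "'a padic_int" is "\<lambda>n. 1 mod int CARD('a) ^ n"
  using prime_card_power_pos[where 'p = 'a]
  by (simp add: mod_power_Suc_mod del: power_Suc)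

lift_definition plus_padic_int :: "'a padic_int \<Rightarrow> 'a padic_int \<Rightarrow> 'a padic_int"
  is "\<lambda>f g n. (f n + g n) mod int CARD('a) ^ n"
proof -
  fix f g :: "nat \<Rightarrow> int" and n :: nat
  assume f: "\<And>n. f n \<in> {0..<int CARD('a) ^ n} \<and> f (Suc n) mod int CARD('a) ^ n = f n"
    and g: "\<And>n. g n \<in> {0..<int CARD('a) ^ n} \<and> g (Suc n) mod int CARD('a) ^ n = g n"
  show "(f n + g n) mod int CARD('a) ^ n \<in> {0..<int CARD('a) ^ n} \<and>
      (f (Suc n) + g (Suc n)) mod int CARD('a) ^ Suc n mod int CARD('a) ^ n =
      (f n + g n) mod int CARD('a) ^ n"
    unfolding mod_power_Suc_mod using prime_card_power_pos[where 'p = 'a] f g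
    by (metis atLeastLessThan_iff mod_add_eq pos_mod_bound pos_mod_sign)
qed

lift_definition times_padic_int :: "'a padic_int \<Rightarrow> 'a padic_int \<Rightarrow> 'a padic_int"
  is "\<lambda>f g n. (f n * g n) mod int CARD('a) ^ n"
proof -
  fix f g :: "nat \<Rightarrow> int" and n :: nat
  assume f: "\<And>n. f n \<in> {0..<int CARD('a) ^ n} \<and> f (Suc n) mod int CARD('a) ^ n = f n"
    and g: "\<And>n. g n \<in> {0..<int CARD('a) ^ n} \<and> g (Suc n) mod int CARD('a) ^ n = g n"
  show "(f n * g n) mod int CARD('a) ^ n \<in> {0..<int CARD('a) ^ n} \<and>
      (f (Suc n) * g (Suc n)) mod int CARD('a) ^ Suc n mod int CARD('a) ^ n =
      (f n * g n) mod int CARD('a) ^ n"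
    unfolding mod_power_Suc_mod using prime_card_power_pos[where 'p = 'a] f g
    by (metis atLeastLessThan_iff mod_mult_eq pos_mod_bound pos_mod_sign)
qed

lift_definition uminus_padic_int :: "'a padic_int \<Rightarrow> 'a padic_int"
  is "\<lambda>f n. (- f n) mod int CARD('a) ^ n"
proof -
  fix f :: "nat \<Rightarrow> int" and n :: nat
  assume f: "\<And>n. f n \<in> {0..<int CARD('a) ^ n} \<and> f (Suc n) mod int CARD('a) ^ n = f n"
  show "(- f n) mod int CARD('a) ^ n \<in> {0..<int CARD('a) ^ n} \<and>
      (- f (Suc n)) mod int CARD('a) ^ Suc n mod int CARD('a) ^ n =
      (- f n) mod int CARD('a) ^ n"
    unfolding mod_power_Suc_mod using prime_card_power_pos[where 'p = 'a] f
    by (metis atLeastLessThan_iff mod_minus_eq pos_mod_bound pos_mod_sign)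
qed

definition minus_padic_int :: "'a padic_int \<Rightarrow> 'a padic_int \<Rightarrow> 'a padic_int"
  where "minus_padic_int x y = x + - y"

instance
proof
  fix a b c :: "'a padic_int"
  show "a + b + c = a + (b + c)"
    by transfer (simp add: mod_simps add.assoc)
  show "a + b = b + a"
    by transfer (simp add: add.commute)
  show "0 + a = a"
    by transfer auto
  show "- a + a = 0"
    by transfer (simp add: mod_simps)
  show "a - b = a + - b"
    by (rule minus_padic_int_def)
  show "a * b * c = a * (b * c)"
    by transfer (simp add: mod_simps mult.assoc)
  show "a * b = b * a"
    by transfer (simp add: mult.commute)
  show "1 * a = a"
    by transfer (auto simp add: mod_simps)
  show "(a + b) * c = a * c + b * c"
    by transfer (simp add: mod_simps distrib_right)
  show "(0 :: 'a padic_int) \<noteq> 1"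
  proof
    assume "(0 :: 'a padic_int) = 1"
    then have "padic_residue (0 :: 'a padic_int) 1 = padic_residue 1 1"
      by simp
    then show False
      using prime_gt_1_nat[OF prime_card[where 'a = 'a]]
      by (simp add: zero_padic_int.rep_eq one_padic_int.rep_eq)
  qed
qed

end

lemma padic_residue_mod:
  fixes x :: "'p::prime_card padic_int"
  shows "padic_residue x (n + m) mod int CARD('p) ^ n = padic_residue x n"
proof (induction m)
  case 0
  show ?case
    using padic_residue[of x] by auto
next
  case (Suc m)
  have "padic_residue x (n + Suc m) mod int CARD('p) ^ n =
        padic_residue x (Suc (n + m)) mod int CARD('p) ^ (n + m) mod int CARD('p) ^ n"
    by (simp add: mod_mod_cancel le_imp_power_dvd)
  also have "\<dots> = padic_residue x (n + m) mod int CARD('p) ^ n"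
    using padic_residue[of x] by auto
  finally show ?case
    using Suc.IH by simp
qed

lemma padic_residue_of_nat:
  "padic_residue (of_nat k :: 'p::prime_card padic_int) n = int k mod int CARD('p) ^ n"
  by (induction k)
    (simp_all add: zero_padic_int.rep_eq one_padic_int.rep_eq plus_padic_int.rep_eq mod_simps)

instance padic_int :: (prime_card) idom
proof
  fix a b :: "'a padic_int"
  let ?p = "int CARD('a)"
  assume "a \<noteq> 0" "b \<noteq> 0"
  then obtain m n where m: "padic_residue a m \<noteq> 0" and n: "padic_residue b n \<noteq> 0"
    by (metis zero_padic_int.rep_eq ext padic_residue_inject)
  define u v where "u = padic_residue a (m + n)" and "v = padic_residue b (n + m)"
  have u: "\<not> ?p ^ m dvd u" and v: "\<not> ?p ^ n dvd v"
    using m n padic_residue_mod[of a m n] padic_residue_mod[of b n m]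
    by (auto simp: u_def v_def mod_eq_0_iff_dvd)
  have p: "prime ?p"
    by (rule prime_card_int)
  have nz: "u \<noteq> 0" "v \<noteq> 0"
    using u v by auto
  have "multiplicity ?p u < m" "multiplicity ?p v < n"
    using u v nz p by (meson multiplicity_dvd' not_le)+
  then have "multiplicity ?p (u * v) < m + n"
    using nz p by (simp add: prime_elem_multiplicity_mult_distrib)
  then have "\<not> ?p ^ (m + n) dvd u * v"
    using nz p by (meson multiplicity_geI mult_eq_0_iff not_less prime_elem_not_unit prime_imp_prime_elem)
  then have "padic_residue (a * b) (m + n) \<noteq> 0"
    by (simp add: times_padic_int.rep_eq u_def v_def add.commute mod_eq_0_iff_dvd)
  then show "a * b \<noteq> 0"
    by (auto simp: zero_padic_int.rep_eq)
qed

instance padic_int :: (prime_card) ring_char_0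
proof
  show "inj (of_nat :: nat \<Rightarrow> 'a padic_int)"
  proof (rule injI)
    fix j k :: nat
    assume eq: "(of_nat j :: 'a padic_int) = of_nat k"
    let ?p = "CARD('a)" and ?n = "max j k"
    have "?n < ?p ^ ?n"
      using prime_gt_1_nat[OF prime_card[where 'a = 'a]] by (intro power_gt_expt) simp
    then have "int j < int ?p ^ ?n" "int k < int ?p ^ ?n"
      by (metis max_less_iff_conj of_nat_less_iff of_nat_power le_less_trans max.cobounded1 max.cobounded2)+
    moreover have "int j mod int ?p ^ ?n = int k mod int ?p ^ ?n"
      using eq by (metis padic_residue_of_nat)
    ultimately show "j = k"
      by simp
  qed
qed

instance fract :: ("{idom, ring_char_0}") field_char_0
proof
  have "of_nat k = to_fract (of_nat k :: 'a)" for k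
    by (induction k) simp_all
  then show "inj (of_nat :: nat \<Rightarrow> 'a fract)"
    by (auto intro!: injI)
qed

type_synonym 'p padic = "'p padic_int fract"

definition padic_Ints :: "'p::prime_card padic set"
  where "padic_Ints = range to_fract"

text \<open>The congruence \<open>a \<equiv> b\<close> modulo \<open>p ^ m\<close> of \<open>p\<close>-adic numbers.\<close>

definition padic_cong :: "nat \<Rightarrow> 'p::prime_card padic \<Rightarrow> 'p padic \<Rightarrow> bool"
  where "padic_cong m a b \<longleftrightarrow> (a - b) / of_nat CARD('p) ^ m \<in> padic_Ints"

definition least_residue :: "'p::prime_card padic \<Rightarrow> nat"
  where "least_residue x = (LEAST r. padic_cong 1 x (of_nat r))"

definition D_poly :: "nat \<Rightarrow> 'a::field_char_0 \<Rightarrow> 'a \<Rightarrow> 'a"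
  where "D_poly n x y = (\<Sum>k=0..n. of_nat (n choose k) * (x gchoose k) * y ^ k)"

definition S_poly :: "nat \<Rightarrow> 'a::field_char_0 \<Rightarrow> 'a \<Rightarrow> 'a"
  where "S_poly n x y =
    (\<Sum>k=0..n. of_nat (n choose k) * (x gchoose k) * ((- 1 - x) gchoose k) * y ^ k)"

end

theory Submission
  imports Defs "HOL-Computational_Algebra.Formal_Power_Series"
begin

text \<open>
  Both \<open>D\<^sub>n(x, y)\<close> and \<open>S\<^sub>n(x, y)\<close> are binomial transforms \<open>\<Sum>k\<le>n. (n choose k) * a k\<close>.
  Let \<open>r\<close> and \<open>s\<close> be the least residues of \<open>x\<close> and \<open>- 1 - x\<close>, so that \<open>r + s = p - 1\<close>.
  Modulo \<open>p\<close> the coefficients of \<open>D\<^sub>n(x, y)\<close> vanish between \<open>r\<close> and \<open>p\<close>, those of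
  \<open>D\<^sub>n(- 1 - x, y)\<close> between \<open>s\<close> and \<open>p\<close>, and those of \<open>S\<^sub>n(x, y)\<close> between \<open>min r s\<close> and \<open>p\<close>.
  Expanding \<open>(n choose j) * (n choose k)\<close> in the basis \<open>n choose m\<close> shows that its sum over
  \<open>n < p\<close> is divisible by \<open>p\<close> if \<open>j + k < p - 1\<close> and congruent to \<open>(- 1) ^ j\<close> if \<open>j + k = p - 1\<close>.
  Hence at most the product of the two top coefficients survives, and \<open>y ^ (p - 1)\<close> is \<open>1\<close>.
  The second sum in (i) equals the first one term by term, by the Pfaff transformation of the
  terminating hypergeometric series \<open>D\<^sub>n\<close>.
\<close>

section \<open>Binomial transforms\<close>

definition binomial_transform :: "(nat \<Rightarrow> 'a::semiring_1) \<Rightarrow> nat \<Rightarrow> 'a"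
  where "binomial_transform a n = (\<Sum>k\<le>n. of_nat (n choose k) * a k)"

lemma binomial_transform_eq_sum:
  assumes "finite A" and "{..n} \<subseteq> A"
  shows "binomial_transform a n = (\<Sum>k\<in>A. of_nat (n choose k) * a k)"
  unfolding binomial_transform_def using assms
  by (intro sum.mono_neutral_left ballI) (simp_all add: binomial_eq_0)

lemma sum_binomial_mult_binomial_power:
  fixes c :: "'a::comm_semiring_1"
  shows "(\<Sum>m\<le>n. of_nat ((n choose m) * (m choose k)) * c ^ m) =
    of_nat (n choose k) * c ^ k * (1 + c) ^ (n - k)"
proof (cases "k \<le> n")
  case True
  have "(\<Sum>m\<le>n. of_nat ((n choose m) * (m choose k)) * c ^ m) =
      (\<Sum>m=k..n. of_nat ((n choose m) * (m choose k)) * c ^ m)"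
    by (intro sum.mono_neutral_right ballI) (auto simp: binomial_eq_0)
  also have "\<dots> =
      (\<Sum>m=k..n. of_nat (n choose k) * c ^ k * (of_nat ((n - k) choose (m - k)) * c ^ (m - k)))"
  proof (rule sum.cong)
    fix m assume "m \<in> {k..n}"
    then have "(n choose m) * (m choose k) = (n choose k) * ((n - k) choose (m - k))"
      and "c ^ m = c ^ k * c ^ (m - k)"
      by (simp_all add: choose_mult flip: power_add)
    then show "of_nat ((n choose m) * (m choose k)) * c ^ m =
        of_nat (n choose k) * c ^ k * (of_nat ((n - k) choose (m - k)) * c ^ (m - k))"
      by (simp add: mult_ac)
  qed simp
  also have "\<dots> = of_nat (n choose k) * c ^ k *
      (\<Sum>i\<le>n - k. of_nat ((n - k) choose i) * c ^ i)"
    unfolding sum_distrib_left[symmetric]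
    by (rule arg_cong, rule sum.reindex_bij_witness[of _ "\<lambda>i. i + k" "\<lambda>m. m - k"])
      (use True in auto)
  also have "(\<Sum>i\<le>n - k. of_nat ((n - k) choose i) * c ^ i) = (1 + c) ^ (n - k)"
    by (simp add: binomial_ring[of c 1] add.commute[of 1 c])
  finally show ?thesis .
next
  case False
  then show ?thesis
    by (simp add: binomial_eq_0)
qed

lemma binomial_transform_power_mult_binomial_transform:
  fixes c :: "'a::comm_semiring_1"
  shows "binomial_transform (\<lambda>m. c ^ m * binomial_transform a m) n =
    (\<Sum>k\<le>n. of_nat (n choose k) * c ^ k * (1 + c) ^ (n - k) * a k)"
proof -
  have "binomial_transform (\<lambda>m. c ^ m * binomial_transform a m) n =
      (\<Sum>m\<le>n. of_nat (n choose m) * (c ^ m * (\<Sum>k\<le>n. of_nat (m choose k) * a k)))"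
    unfolding binomial_transform_def[of "\<lambda>m. c ^ m * binomial_transform a m"]
    by (intro sum.cong) (auto simp: binomial_transform_eq_sum[of "{..n}"])
  also have "\<dots> = (\<Sum>m\<le>n. \<Sum>k\<le>n. of_nat ((n choose m) * (m choose k)) * c ^ m * a k)"
    by (simp add: sum_distrib_left mult_ac)
  also have "\<dots> = (\<Sum>k\<le>n. (\<Sum>m\<le>n. of_nat ((n choose m) * (m choose k)) * c ^ m) * a k)"
    unfolding sum_distrib_right by (rule sum.swap)
  also have "\<dots> = (\<Sum>k\<le>n. of_nat (n choose k) * c ^ k * (1 + c) ^ (n - k) * a k)"
    by (simp only: sum_binomial_mult_binomial_power)
  finally show ?thesis .
qed

lemma binomial_transform_gbinomial:
  fixes x :: "'a::field_char_0"
  shows "binomial_transform ((gchoose) x) n = (- 1) ^ n * ((- 1 - x) gchoose n)"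
proof -
  have "binomial_transform ((gchoose) x) n =
      (\<Sum>k=0..n. (x gchoose k) * (of_nat n gchoose (n - k)))"
    unfolding binomial_transform_def atMost_atLeast0
    by (intro sum.cong)
      (simp_all add: binomial_symmetric[symmetric] mult.commute flip: binomial_gbinomial)
  also have "\<dots> = (x + of_nat n) gchoose n"
    by (rule gbinomial_Vandermonde)
  also have "\<dots> = (- 1) ^ n * ((- 1 - x) gchoose n)"
    using gbinomial_negated_upper[of "x + of_nat n" n] by (simp add: minus_diff_commute)
  finally show ?thesis .
qed

definition D_coeff :: "'a::field_char_0 \<Rightarrow> 'a \<Rightarrow> nat \<Rightarrow> 'a"
  where "D_coeff x y k = (x gchoose k) * y ^ k"

definition S_coeff :: "'a::field_char_0 \<Rightarrow> 'a \<Rightarrow> nat \<Rightarrow> 'a"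
  where "S_coeff x y k = (x gchoose k) * ((- 1 - x) gchoose k) * y ^ k"

lemma D_poly_eq_binomial_transform: "D_poly n x y = binomial_transform (D_coeff x y) n"
  by (simp add: D_poly_def D_coeff_def binomial_transform_def atMost_atLeast0 mult.assoc)

lemma S_poly_eq_binomial_transform: "S_poly n x y = binomial_transform (S_coeff x y) n"
  by (simp add: S_poly_def S_coeff_def binomial_transform_def atMost_atLeast0 mult.assoc)

lemma D_poly_Pfaff:
  fixes x y :: "'a::field_char_0"
  assumes "y \<noteq> 1"
  shows "(1 - y) ^ n * D_poly n x (y / (y - 1)) = D_poly n (- 1 - x) y"
proof -
  have split: "(1 - y) ^ n * (y / (y - 1)) ^ k = (- y) ^ k * (1 - y) ^ (n - k)" if "k \<le> n" for k
  proof -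
    have "(1 - y) ^ n * (y / (y - 1)) ^ k = ((1 - y) ^ k * (1 - y) ^ (n - k)) * (y / (y - 1)) ^ k"
      using that by (simp flip: power_add)
    also have "\<dots> = ((1 - y) * (y / (y - 1))) ^ k * (1 - y) ^ (n - k)"
      by (simp only: power_mult_distrib mult_ac)
    also have "(1 - y) * (y / (y - 1)) = - y"
      using assms by (simp add: field_simps)
    finally show ?thesis .
  qed
  have sign: "y ^ m = (- y) ^ m * (- 1) ^ m" for m
    by (simp flip: power_mult_distrib)
  have "(1 - y) ^ n * D_poly n x (y / (y - 1)) =
      (\<Sum>k\<le>n. of_nat (n choose k) * (x gchoose k) * ((1 - y) ^ n * (y / (y - 1)) ^ k))"
    by (simp add: D_poly_def sum_distrib_left atMost_atLeast0 mult_ac)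
  also have "\<dots> = (\<Sum>k\<le>n. of_nat (n choose k) * (- y) ^ k * (1 + - y) ^ (n - k) * (x gchoose k))"
    by (intro sum.cong) (simp_all add: split mult_ac)
  also have "\<dots> = binomial_transform (\<lambda>m. (- y) ^ m * binomial_transform ((gchoose) x) m) n"
    by (rule binomial_transform_power_mult_binomial_transform[symmetric])
  also have "\<dots> = binomial_transform (D_coeff (- 1 - x) y) n"
    by (simp only: binomial_transform_gbinomial D_coeff_def[abs_def] sign mult_ac)
  finally show ?thesis
    by (simp only: D_poly_eq_binomial_transform)
qed

lemma binomial_mult_binomial:
  "(n choose j) * (n choose k) =
     (\<Sum>i\<le>k. (j choose (k - i)) * ((j + i) choose j) * (n choose (j + i)))"
proof (cases "j \<le> n")
  case True
  have "(n choose k) = (\<Sum>i\<le>k. ((n - j) choose i) * (j choose (k - i)))"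
    using vandermonde[of "n - j" j k] True by simp
  moreover have "(n choose j) * ((n - j) choose i) = ((j + i) choose j) * (n choose (j + i))" for i
  proof (cases "j + i \<le> n")
    case True
    then show ?thesis
      using choose_mult[of j "j + i" n] by (simp add: mult.commute)
  next
    case False
    with \<open>j \<le> n\<close> show ?thesis
      by (simp add: binomial_eq_0)
  qed
  ultimately show ?thesis
    by (simp add: sum_distrib_left) (intro sum.cong refl, metis mult.assoc mult.commute)
qed (simp add: binomial_eq_0)

definition binomial_gram :: "nat \<Rightarrow> nat \<Rightarrow> nat \<Rightarrow> nat"
  where "binomial_gram N j k = (\<Sum>n<N. (n choose j) * (n choose k))"

lemma binomial_gram_eq_sum:
  "binomial_gram N j k =
     (\<Sum>i\<le>k. (j choose (k - i)) * ((j + i) choose j) * (N choose Suc (j + i)))"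
proof -
  have "(\<Sum>n<N. n choose m) = N choose Suc m" for m
    by (cases N) (simp_all add: lessThan_Suc_atMost sum_choose_upper)
  then show ?thesis
    unfolding binomial_gram_def binomial_mult_binomial
    by (subst sum.swap) (simp flip: sum_distrib_left)
qed

lemma sum_binomial_transform_mult:
  fixes a b :: "nat \<Rightarrow> 'a::comm_semiring_1"
  shows "(\<Sum>n<N. binomial_transform a n * binomial_transform b n) =
    (\<Sum>j<N. \<Sum>k<N. a j * b k * of_nat (binomial_gram N j k))"
proof -
  have "(\<Sum>n<N. binomial_transform a n * binomial_transform b n) =
      (\<Sum>n<N. (\<Sum>j<N. of_nat (n choose j) * a j) * (\<Sum>k<N. of_nat (n choose k) * b k))"
    by (intro sum.cong arg_cong2[where f = "(*)"] binomial_transform_eq_sum) auto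
  also have "\<dots> = (\<Sum>n<N. \<Sum>j<N. \<Sum>k<N. a j * b k * (of_nat (n choose j) * of_nat (n choose k)))"
    by (simp only: sum_product mult_ac)
  also have "\<dots> = (\<Sum>j<N. \<Sum>k<N. \<Sum>n<N. a j * b k * (of_nat (n choose j) * of_nat (n choose k)))"
    by (subst sum.swap) (intro sum.cong refl sum.swap)
  finally show ?thesis
    by (simp only: binomial_gram_def sum_distrib_left of_nat_sum of_nat_mult)
qed

lemma binomial_gram_prime_cong:
  assumes "prime p" and "j + k < p"
  shows "[binomial_gram p j k = (if j + k = p - 1 then (p - 1) choose j else 0)] (mod p)"
proof -
  have "p > 0"
    using assms(1) by (rule prime_gt_0_nat)
  have "[(j choose (k - i)) * ((j + i) choose j) * (p choose Suc (j + i)) =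
      (if i = k then if j + k = p - 1 then (p - 1) choose j else 0 else 0)] (mod p)"
    if "i \<le> k" for i
  proof (cases "i = k \<and> j + k = p - 1")
    case True
    with \<open>p > 0\<close> show ?thesis
      by simp
  next
    case False
    with that assms have "p dvd p choose Suc (j + i)"
      by (intro dvd_choose_prime) auto
    with False show ?thesis
      by (auto simp: cong_0_iff)
  qed
  then have "[binomial_gram p j k =
      (\<Sum>i\<le>k. if i = k then if j + k = p - 1 then (p - 1) choose j else 0 else 0)] (mod p)"
    unfolding binomial_gram_eq_sum by (intro cong_sum) auto
  then show ?thesis
    by simp
qed

section \<open>Divisibility and units in the ring of \<open>p\<close>-adic integers\<close>

lemma padic_int_eqI:
  assumes "\<And>n. padic_residue a n = padic_residue b n"
  shows "a = b"
  using assms by (simp add: fun_eq_iff flip: padic_residue_inject)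

lemma obtain_padic_int:
  assumes "\<And>n. [f (Suc n) = f n] (mod int CARD('p) ^ n)"
  obtains z :: "'p::prime_card padic_int"
  where "\<And>n. padic_residue z n = f n mod int CARD('p) ^ n"
proof
  have "(\<lambda>n. f n mod int CARD('p) ^ n) \<in>
      {f. \<forall>n. f n \<in> {0..<int CARD('p) ^ n} \<and> f (Suc n) mod int CARD('p) ^ n = f n}"
    using assms prime_card_power_pos[where 'p = 'p]
    by (auto simp: mod_power_Suc_mod cong_def simp del: power_Suc)
  then show "padic_residue (Abs_padic_int (\<lambda>n. f n mod int CARD('p) ^ n) :: 'p padic_int) n =
      f n mod int CARD('p) ^ n" for n
    by (simp only: Abs_padic_int_inverse)
qed

lemma padic_residue_mod_self:
  "padic_residue (z :: 'p::prime_card padic_int) n mod int CARD('p) ^ n = padic_residue z n"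
  using padic_residue_mod[of z n 0] by simp

lemma padic_residue_add_cong:
  "[padic_residue (z :: 'p::prime_card padic_int) (n + m) = padic_residue z n]
    (mod int CARD('p) ^ n)"
  by (simp only: cong_def padic_residue_mod padic_residue_mod_self)

lemma padic_residue_diff:
  "padic_residue (a - b :: 'p::prime_card padic_int) n =
    (padic_residue a n - padic_residue b n) mod int CARD('p) ^ n"
  unfolding minus_padic_int_def plus_padic_int.rep_eq uminus_padic_int.rep_eq
  by (simp add: mod_simps)

lemma padic_residue_of_int:
  "padic_residue (of_int k :: 'p::prime_card padic_int) n = k mod int CARD('p) ^ n"
  by (cases k rule: int_diff_cases) (simp add: padic_residue_diff padic_residue_of_nat mod_simps)

lemma power_card_dvd_padic_int_iff:
  fixes z :: "'p::prime_card padic_int"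
  shows "of_nat CARD('p) ^ m dvd z \<longleftrightarrow> padic_residue z m = 0"
proof
  assume "of_nat CARD('p) ^ m dvd z"
  then obtain w where "z = of_nat (CARD('p) ^ m) * w"
    by (auto elim: dvdE)
  then show "padic_residue z m = 0"
    by (simp only: times_padic_int.rep_eq padic_residue_of_nat) (simp add: mod_simps)
next
  let ?p = "int CARD('p)"
  assume "padic_residue z m = 0"
  define f where "f n = padic_residue z (m + n) div ?p ^ m" for n
  have f: "padic_residue z (m + n) = ?p ^ m * f n" for n
  proof -
    have "?p ^ m dvd padic_residue z (m + n)"
      using padic_residue_mod[of z m n] \<open>padic_residue z m = 0\<close> by (simp add: mod_eq_0_iff_dvd)
    then show ?thesis
      by (simp add: f_def)
  qed
  have "[f (Suc n) = f n] (mod ?p ^ n)" for n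
  proof -
    have "[padic_residue z (m + Suc n) = padic_residue z (m + n)] (mod ?p ^ (m + n))"
      using padic_residue_add_cong[of z "m + n" 1] by simp
    then show ?thesis
      unfolding f cong_iff_dvd_diff power_add right_diff_distrib[symmetric] by simp
  qed
  then obtain w :: "'p padic_int" where w: "\<And>n. padic_residue w n = f n mod ?p ^ n"
    by (rule obtain_padic_int) blast
  have "padic_residue z n = padic_residue (of_nat (CARD('p) ^ m) * w) n" for n
  proof -
    have "padic_residue z n = ?p ^ m * f n mod ?p ^ n"
      using padic_residue_mod[of z n m] by (simp add: f[symmetric] add.commute)
    also have "\<dots> = padic_residue (of_nat (CARD('p) ^ m) * w) n"
      by (simp only: times_padic_int.rep_eq padic_residue_of_nat w) (simp add: mod_simps)
    finally show ?thesis .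
  qed
  then show "of_nat CARD('p) ^ m dvd z"
    by (metis dvd_triv_left of_nat_power padic_int_eqI)
qed

lemma padic_int_dvd_oneI:
  fixes z :: "'p::prime_card padic_int"
  assumes "padic_residue z 1 \<noteq> 0"
  shows "z dvd 1"
proof -
  let ?p = "int CARD('p)"
  have coprime: "coprime (padic_residue z n) (?p ^ n)" for n
  proof (cases n)
    case (Suc k)
    have "\<not> ?p dvd padic_residue z n"
      using assms padic_residue_mod[of z 1 k] Suc by (auto simp: mod_eq_0_iff_dvd)
    then have "coprime ?p (padic_residue z n)"
      by (rule prime_imp_coprime[OF prime_card_int])
    then show ?thesis
      by (simp add: coprime_commute)
  qed simp
  then have "\<forall>n. \<exists>w. [padic_residue z n * w = 1] (mod ?p ^ n)"
    by (blast intro: cong_solve_coprime_int)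
  then obtain f where f: "\<And>n. [padic_residue z n * f n = 1] (mod ?p ^ n)"
    by metis
  have "[f (Suc n) = f n] (mod ?p ^ n)" for n
  proof -
    have "[padic_residue z n = padic_residue z (Suc n)] (mod ?p ^ n)"
      using padic_residue_add_cong[of z n 1] by (simp add: cong_sym)
    then have "[padic_residue z n * f (Suc n) = padic_residue z (Suc n) * f (Suc n)] (mod ?p ^ n)"
      by (rule cong_mult) simp
    also have "[padic_residue z (Suc n) * f (Suc n) = 1] (mod ?p ^ n)"
      using f[of "Suc n"] by (rule cong_dvd_modulus) simp
    also have "[1 = padic_residue z n * f n] (mod ?p ^ n)"
      using f by (rule cong_sym)
    finally show ?thesis
      using cong_mult_lcancel[OF coprime] by blast
  qed
  then obtain w :: "'p padic_int" where w: "\<And>n. padic_residue w n = f n mod ?p ^ n"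
    by (rule obtain_padic_int) blast
  have "z * w = 1"
    using f by (intro padic_int_eqI)
      (simp add: times_padic_int.rep_eq one_padic_int.rep_eq w mod_simps cong_def)
  then show ?thesis
    by (metis dvd_triv_left)
qed

section \<open>Congruences between \<open>p\<close>-adic numbers\<close>

lemma to_fract_of_nat [simp]: "to_fract (of_nat n) = of_nat n"
  by (simp add: to_fract_def of_nat_fract)

lemma to_fract_of_int [simp]: "to_fract (of_int k) = of_int k"
  by (cases k rule: int_diff_cases) simp

lemma padic_Ints_to_fract [simp]: "to_fract z \<in> padic_Ints"
  by (simp add: padic_Ints_def)

lemma padic_Ints_of_nat [simp]: "of_nat n \<in> padic_Ints"
  by (metis padic_Ints_to_fract to_fract_of_nat)

lemma padic_Ints_0 [simp]: "0 \<in> padic_Ints"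
  using padic_Ints_of_nat[of 0] by simp

lemma padic_Ints_1 [simp]: "1 \<in> padic_Ints"
  using padic_Ints_of_nat[of 1] by simp

lemma padic_Ints_add [simp]: "a \<in> padic_Ints \<Longrightarrow> b \<in> padic_Ints \<Longrightarrow> a + b \<in> padic_Ints"
  unfolding padic_Ints_def by (auto simp flip: to_fract_add)

lemma padic_Ints_mult [simp]: "a \<in> padic_Ints \<Longrightarrow> b \<in> padic_Ints \<Longrightarrow> a * b \<in> padic_Ints"
  unfolding padic_Ints_def by (auto simp flip: to_fract_mult)

lemma padic_Ints_minus [simp]: "a \<in> padic_Ints \<Longrightarrow> - a \<in> padic_Ints"
  unfolding padic_Ints_def by (auto simp flip: to_fract_uminus)

lemma padic_Ints_diff [simp]: "a \<in> padic_Ints \<Longrightarrow> b \<in> padic_Ints \<Longrightarrow> a - b \<in> padic_Ints"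
  unfolding padic_Ints_def by (auto simp flip: to_fract_diff)

lemma padic_Ints_power [simp]: "a \<in> padic_Ints \<Longrightarrow> a ^ n \<in> padic_Ints"
  by (induction n) simp_all

lemma padic_Ints_prod: "(\<And>i. i \<in> A \<Longrightarrow> f i \<in> padic_Ints) \<Longrightarrow> prod f A \<in> padic_Ints"
  by (induction A rule: infinite_finite_induct) simp_all

lemma padic_cong_refl [simp]: "padic_cong m a a"
  by (simp add: padic_cong_def)

lemma padic_cong_add:
  "padic_cong m a b \<Longrightarrow> padic_cong m c d \<Longrightarrow> padic_cong m (a + c) (b + d)"
  unfolding padic_cong_def by (drule (1) padic_Ints_add) (simp add: add_diff_add add_divide_distrib)

lemma padic_cong_minus: "padic_cong m a b \<Longrightarrow> padic_cong m (- a) (- b)"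
  unfolding padic_cong_def
  by (drule padic_Ints_minus) (simp add: minus_divide_left del: divide_minus_left)

lemma padic_cong_diff:
  "padic_cong m a b \<Longrightarrow> padic_cong m c d \<Longrightarrow> padic_cong m (a - c) (b - d)"
  using padic_cong_add[OF _ padic_cong_minus, of m a b c d] by simp

lemma padic_cong_sym: "padic_cong m a b \<Longrightarrow> padic_cong m b a"
  using padic_cong_diff[of m "a + b" "a + b" a b] by simp

lemma padic_cong_trans [trans]: "padic_cong m a b \<Longrightarrow> padic_cong m b c \<Longrightarrow> padic_cong m a c"
  using padic_cong_diff[OF padic_cong_add[of m a b b c] padic_cong_refl[of m b]] by simp

lemma padic_cong_mult:
  assumes "padic_cong m a b" "padic_cong m c d" "a \<in> padic_Ints" "d \<in> padic_Ints"
  shows "padic_cong m (a * c) (b * d)"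
proof -
  let ?q = "of_nat CARD('a) ^ m :: 'a padic"
  have "(a * c - b * d) / ?q = a * ((c - d) / ?q) + (a - b) / ?q * d"
    by (simp add: algebra_simps diff_divide_distrib)
  then show ?thesis
    using assms unfolding padic_cong_def by (metis padic_Ints_add padic_Ints_mult)
qed

lemma padic_cong_mult_0:
  "padic_cong m a 0 \<Longrightarrow> b \<in> padic_Ints \<Longrightarrow> padic_cong m (a * b) 0"
  unfolding padic_cong_def by (drule (1) padic_Ints_mult) simp

lemma padic_cong_power:
  "padic_cong m a b \<Longrightarrow> a \<in> padic_Ints \<Longrightarrow> b \<in> padic_Ints \<Longrightarrow> padic_cong m (a ^ n) (b ^ n)"
  by (induction n) (simp_all add: padic_cong_mult)

lemma padic_cong_sum:
  "(\<And>i. i \<in> A \<Longrightarrow> padic_cong m (f i) (g i)) \<Longrightarrow> padic_cong m (sum f A) (sum g A)"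
  by (induction A rule: infinite_finite_induct) (simp_all add: padic_cong_add)

lemma padic_cong_prod:
  "(\<And>i. i \<in> A \<Longrightarrow> padic_cong m (f i) (g i)) \<Longrightarrow> (\<And>i. i \<in> A \<Longrightarrow> f i \<in> padic_Ints) \<Longrightarrow>
    (\<And>i. i \<in> A \<Longrightarrow> g i \<in> padic_Ints) \<Longrightarrow> padic_cong m (prod f A) (prod g A)"
  by (induction A rule: infinite_finite_induct) (simp_all add: padic_cong_mult padic_Ints_prod)

lemma padic_cong_to_fract_iff:
  fixes a b :: "'p::prime_card padic_int"
  shows "padic_cong m (to_fract a) (to_fract b) \<longleftrightarrow> padic_residue a m = padic_residue b m"
proof -
  let ?q = "of_nat CARD('p) ^ m :: 'p padic_int"
  have "of_nat CARD('p) ^ m = to_fract ?q"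
    by (metis of_nat_power to_fract_of_nat)
  moreover have "to_fract ?q \<noteq> 0"
    by simp
  ultimately have "padic_cong m (to_fract a) (to_fract b) \<longleftrightarrow>
      (\<exists>c. to_fract (a - b) = to_fract (?q * c))"
    unfolding padic_cong_def padic_Ints_def by (auto simp: field_simps)
  also have "\<dots> \<longleftrightarrow> ?q dvd a - b"
    by (simp only: to_fract_eq_iff dvd_def)
  also have "\<dots> \<longleftrightarrow> padic_residue a m mod int CARD('p) ^ m = padic_residue b m mod int CARD('p) ^ m"
    by (simp add: power_card_dvd_padic_int_iff padic_residue_diff mod_eq_dvd_iff mod_eq_0_iff_dvd)
  finally show ?thesis
    by (simp only: padic_residue_mod_self)
qed

lemma padic_cong_of_int_iff:
  "padic_cong m (of_int a) (of_int b :: 'p::prime_card padic) \<longleftrightarrow> [a = b] (mod int CARD('p) ^ m)"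
  using padic_cong_to_fract_iff[of m "of_int a :: 'p padic_int" "of_int b"]
  by (simp only: to_fract_of_int padic_residue_of_int cong_def)

lemma padic_cong_of_nat_iff:
  "padic_cong m (of_nat a) (of_nat b :: 'p::prime_card padic) \<longleftrightarrow> [a = b] (mod CARD('p) ^ m)"
  using padic_cong_of_int_iff[of m "int a" "int b", where 'p = 'p]
  by (simp only: of_int_of_nat_eq cong_int_iff flip: of_nat_power)

lemma padic_Ints_inverse:
  fixes x :: "'p::prime_card padic"
  assumes "x \<in> padic_Ints" and "\<not> padic_cong 1 x 0"
  shows "inverse x \<in> padic_Ints"
proof -
  obtain z where z: "x = to_fract z"
    using assms(1) by (auto simp: padic_Ints_def)
  then have "padic_residue z 1 \<noteq> 0"
    using assms(2) padic_cong_to_fract_iff[of 1 z 0] by (simp add: zero_padic_int.rep_eq)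
  then have "z dvd 1"
    by (rule padic_int_dvd_oneI)
  then obtain w where "1 = z * w"
    by (rule dvdE)
  then have "x * to_fract w = 1"
    by (metis z to_fract_1 to_fract_mult)
  then show ?thesis
    by (metis inverse_unique padic_Ints_to_fract)
qed

lemma padic_Ints_of_nat_mult_iff:
  fixes a :: "'p::prime_card padic"
  assumes "\<not> CARD('p) dvd n"
  shows "of_nat n * a \<in> padic_Ints \<longleftrightarrow> a \<in> padic_Ints"
proof
  assume "of_nat n * a \<in> padic_Ints"
  moreover have "\<not> padic_cong 1 (of_nat n) (of_nat 0 :: 'p padic)"
    using assms unfolding padic_cong_of_nat_iff by (simp add: cong_0_iff)
  then have "inverse (of_nat n) \<in> (padic_Ints :: 'p padic set)"
    by (intro padic_Ints_inverse) simp_all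
  ultimately have "inverse (of_nat n) * (of_nat n * a) \<in> padic_Ints"
    by (simp only: padic_Ints_mult)
  moreover have "n \<noteq> 0"
    using assms by (metis dvd_0_right)
  then have "inverse (of_nat n) * (of_nat n * a) = a"
    by (simp add: field_simps)
  ultimately show "a \<in> padic_Ints"
    by (simp only:)
qed simp

lemma padic_cong_of_nat_mult_iff:
  fixes a b :: "'p::prime_card padic"
  assumes "\<not> CARD('p) dvd n"
  shows "padic_cong m (of_nat n * a) (of_nat n * b) \<longleftrightarrow> padic_cong m a b"
proof -
  have "(of_nat n * a - of_nat n * b) / of_nat CARD('p) ^ m =
      of_nat n * ((a - b) / of_nat CARD('p) ^ m)"
    by (simp only: right_diff_distrib times_divide_eq_right)
  then show ?thesis
    by (simp only: padic_cong_def padic_Ints_of_nat_mult_iff[OF assms])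
qed

lemma padic_cong_minus_half_iff:
  fixes x :: "'p::prime_card padic"
  assumes "CARD('p) \<noteq> 2"
  shows "padic_cong m x (- 1 / 2) \<longleftrightarrow> padic_cong m x (- 1 - x)"
proof -
  have "\<not> CARD('p) dvd 2"
    using assms primes_dvd_imp_eq[OF prime_card[where 'a = 'p] two_is_prime_nat] by blast
  then have "padic_cong m x (- 1 / 2) \<longleftrightarrow> padic_cong m (2 * x) (2 * (- 1 / 2))"
    using padic_cong_of_nat_mult_iff[of 2 m x "- 1 / 2"] by simp
  also have "\<dots> \<longleftrightarrow> padic_cong m x (- 1 - x)"
    by (simp add: padic_cong_def)
  finally show ?thesis .
qed

section \<open>Least residues\<close>

lemma obtain_padic_cong_of_nat:
  fixes x :: "'p::prime_card padic"
  assumes "x \<in> padic_Ints"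
  obtains r where "r < CARD('p) ^ m" "padic_cong m x (of_nat r)"
proof -
  obtain z where z: "x = to_fract z"
    using assms by (auto simp: padic_Ints_def)
  let ?r = "nat (padic_residue z m)"
  have residue: "0 \<le> padic_residue z m" "padic_residue z m < int CARD('p) ^ m"
    using padic_residue[of z] by auto
  then have "?r < CARD('p) ^ m"
    by (simp add: nat_less_iff)
  moreover have "padic_cong m x (of_nat ?r)"
    using padic_cong_to_fract_iff[of m z "of_nat ?r"] residue
    by (simp add: z padic_residue_of_int)
  ultimately show ?thesis
    by (rule that)
qed

lemma padic_cong_least_residue:
  assumes "x \<in> padic_Ints"
  shows "padic_cong 1 x (of_nat (least_residue x))"
proof -
  obtain r where "padic_cong 1 x (of_nat r)"
    using obtain_padic_cong_of_nat[OF assms] by blast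
  then show ?thesis
    unfolding least_residue_def by (rule LeastI)
qed

lemma least_residue_eqI:
  fixes x :: "'p::prime_card padic"
  assumes "r < CARD('p)" and "padic_cong 1 x (of_nat r)"
  shows "least_residue x = r"
  unfolding least_residue_def
proof (rule Least_equality)
  fix q assume "padic_cong 1 x (of_nat q)"
  then have "padic_cong 1 (of_nat r) (of_nat q :: 'p padic)"
    using assms(2) padic_cong_sym padic_cong_trans by blast
  then have "[r = q] (mod CARD('p))"
    by (simp only: padic_cong_of_nat_iff power_one_right)
  then show "r \<le> q"
    using assms(1) by (metis cong_def mod_less mod_less_eq_dividend)
qed fact

lemma least_residue_less:
  fixes x :: "'p::prime_card padic"
  assumes "x \<in> padic_Ints"
  shows "least_residue x < CARD('p)"
  using obtain_padic_cong_of_nat[OF assms, of 1] least_residue_eqI[of _ x] by (metis power_one_right)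

lemma least_residue_eq_iff:
  fixes x y :: "'p::prime_card padic"
  assumes "x \<in> padic_Ints" and "y \<in> padic_Ints"
  shows "least_residue x = least_residue y \<longleftrightarrow> padic_cong 1 x y"
proof
  assume "least_residue x = least_residue y"
  then show "padic_cong 1 x y"
    using assms by (metis padic_cong_least_residue padic_cong_sym padic_cong_trans)
next
  assume "padic_cong 1 x y"
  then have "padic_cong 1 x (of_nat (least_residue y))"
    using padic_cong_least_residue[OF assms(2)] by (rule padic_cong_trans)
  then show "least_residue x = least_residue y"
    using least_residue_less[OF assms(2)] by (intro least_residue_eqI)
qed

lemma least_residue_add_least_residue:
  fixes x :: "'p::prime_card padic"
  assumes "x \<in> padic_Ints"
  shows "least_residue x + least_residue (- 1 - x) = CARD('p) - 1"
proof -
  let ?r = "least_residue x"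
  have less: "?r < CARD('p)"
    using assms by (rule least_residue_less)
  have "padic_cong 1 (0 - 1 - x) (of_nat CARD('p) - 1 - of_nat ?r)"
    using padic_cong_of_nat_iff[of 1 0 "CARD('p)", where 'p = 'p]
    by (intro padic_cong_diff padic_cong_refl padic_cong_least_residue assms)
      (simp add: cong_def)
  also have "of_nat CARD('p) - 1 - of_nat ?r = (of_nat (CARD('p) - 1 - ?r) :: 'p padic)"
    using less by (simp add: of_nat_diff)
  finally have "least_residue (- 1 - x) = CARD('p) - 1 - ?r"
    by (intro least_residue_eqI) simp_all
  then show ?thesis
    using less by simp
qed

lemma padic_power_card_minus_one_cong:
  fixes y :: "'p::prime_card padic"
  assumes "y \<in> padic_Ints" and "\<not> padic_cong 1 y 0"
  shows "padic_cong 1 (y ^ (CARD('p) - 1)) 1"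
proof -
  let ?t = "least_residue y"
  have approx: "padic_cong 1 y (of_nat ?t)"
    using assms(1) by (rule padic_cong_least_residue)
  have "\<not> padic_cong 1 (of_nat ?t) (of_nat 0 :: 'p padic)"
    using assms(2) approx padic_cong_trans[of 1 y "of_nat ?t" 0] by auto
  then have "\<not> CARD('p) dvd ?t"
    unfolding padic_cong_of_nat_iff by (simp add: cong_0_iff)
  then have "[?t ^ (CARD('p) - 1) = 1] (mod CARD('p))"
    by (rule fermat_theorem[OF prime_card])
  then have "padic_cong 1 (of_nat (?t ^ (CARD('p) - 1))) (of_nat 1 :: 'p padic)"
    by (simp only: padic_cong_of_nat_iff power_one_right)
  moreover have "padic_cong 1 (y ^ (CARD('p) - 1)) (of_nat ?t ^ (CARD('p) - 1))"
    using approx assms(1) by (intro padic_cong_power) simp_all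
  ultimately show ?thesis
    using padic_cong_trans by fastforce
qed

section \<open>Binomial coefficients of \<open>p\<close>-adic integers\<close>

lemma fact_mult_gbinomial_padic_cong:
  fixes x y :: "'p::prime_card padic"
  assumes "x \<in> padic_Ints" and "y \<in> padic_Ints" and "padic_cong m x y"
  shows "padic_cong m (fact k * (x gchoose k)) (fact k * (y gchoose k))"
  unfolding gbinomial_mult_fact using assms
  by (intro padic_cong_prod padic_cong_diff) simp_all

lemma gbinomial_padic_cong:
  fixes x y :: "'p::prime_card padic"
  assumes "k < CARD('p)" and "x \<in> padic_Ints" and "y \<in> padic_Ints" and "padic_cong m x y"
  shows "padic_cong m (x gchoose k) (y gchoose k)"
proof -
  have "\<not> CARD('p) dvd fact k"
    using assms(1) prime_card[where 'a = 'p] by (simp add: prime_dvd_fact_iff)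
  from padic_cong_of_nat_mult_iff[OF this] show ?thesis
    using fact_mult_gbinomial_padic_cong[OF assms(2-4), of k] by simp
qed

text \<open>
  Approximating \<open>x\<close> by a natural number modulo a high enough power of \<open>p\<close> reduces the claim to the
  integrality of ordinary binomial coefficients.
\<close>

lemma gbinomial_in_padic_Ints:
  fixes x :: "'p::prime_card padic"
  assumes "x \<in> padic_Ints"
  shows "x gchoose k \<in> padic_Ints"
proof -
  define m where "m = multiplicity CARD('p) (fact k :: nat)"
  obtain u where u: "fact k = CARD('p) ^ m * u" "\<not> CARD('p) dvd u"
    using multiplicity_decompose'[of "fact k" "CARD('p)"] prime_card[where 'a = 'p]
    unfolding m_def by (metis fact_nonzero not_prime_unit)
  have fact: "fact k = (of_nat CARD('p) ^ m * of_nat u :: 'p padic)"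
    by (metis u(1) of_nat_fact of_nat_mult of_nat_power)
  obtain r where "padic_cong m x (of_nat r)"
    using obtain_padic_cong_of_nat[OF assms] by blast
  then have "(fact k * (x gchoose k) - fact k * (of_nat r gchoose k)) / of_nat CARD('p) ^ m
      \<in> padic_Ints"
    using fact_mult_gbinomial_padic_cong[of x "of_nat r" m k] assms by (simp add: padic_cong_def)
  also have "(fact k * (x gchoose k) - fact k * (of_nat r gchoose k)) / of_nat CARD('p) ^ m =
      of_nat u * ((x gchoose k) - of_nat (r choose k))"
    unfolding fact binomial_gbinomial by (simp add: field_simps)
  finally have "(x gchoose k) - of_nat (r choose k) \<in> padic_Ints"
    by (simp only: padic_Ints_of_nat_mult_iff[OF u(2)])
  then have "(x gchoose k) - of_nat (r choose k) + of_nat (r choose k) \<in> padic_Ints"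
    by (rule padic_Ints_add) simp
  then show ?thesis
    by simp
qed

lemma gbinomial_padic_cong_least_residue:
  fixes x :: "'p::prime_card padic"
  assumes "k < CARD('p)" and "x \<in> padic_Ints"
  shows "padic_cong 1 (x gchoose k) (of_nat (least_residue x choose k))"
  unfolding binomial_gbinomial using assms
  by (intro gbinomial_padic_cong padic_cong_least_residue) simp_all

lemma gbinomial_least_residue_padic_cong_1:
  fixes x :: "'p::prime_card padic"
  assumes "x \<in> padic_Ints"
  shows "padic_cong 1 (x gchoose least_residue x) 1"
  using gbinomial_padic_cong_least_residue[OF least_residue_less[OF assms] assms] by simp

lemma gbinomial_padic_cong_0:
  fixes x :: "'p::prime_card padic"
  assumes "least_residue x < k" and "k < CARD('p)" and "x \<in> padic_Ints"
  shows "padic_cong 1 (x gchoose k) 0"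
  using gbinomial_padic_cong_least_residue[OF assms(2,3)] assms(1) by (simp add: binomial_eq_0)

lemma binomial_card_minus_one_padic_cong:
  assumes "k < CARD('p)"
  shows "padic_cong 1 (of_nat ((CARD('p) - 1) choose k)) ((- 1) ^ k :: 'p::prime_card padic)"
proof -
  have "least_residue (- 1 :: 'p padic) = CARD('p) - 1"
    using least_residue_add_least_residue[of "0 :: 'p padic"] least_residue_eqI[of 0 "0 :: 'p padic"]
    by simp
  then have "padic_cong 1 ((- 1 :: 'p padic) gchoose k) (of_nat ((CARD('p) - 1) choose k))"
    using gbinomial_padic_cong_least_residue[of k "- 1 :: 'p padic"] assms by simp
  moreover have "(- 1 :: 'p padic) gchoose k = (- 1) ^ k"
    by (simp add: gbinomial_minus flip: binomial_gbinomial)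
  ultimately show ?thesis
    by (simp add: padic_cong_sym)
qed

section \<open>Sums of products of binomial transforms modulo \<open>p\<close>\<close>

lemma binomial_gram_padic_cong:
  assumes "j + k < CARD('p)"
  shows "padic_cong 1 (of_nat (binomial_gram CARD('p) j k))
    (if j + k = CARD('p) - 1 then (- 1) ^ j else 0 :: 'p::prime_card padic)"
proof -
  have "padic_cong 1 (of_nat (binomial_gram CARD('p) j k))
      (of_nat (if j + k = CARD('p) - 1 then (CARD('p) - 1) choose j else 0) :: 'p padic)"
    unfolding padic_cong_of_nat_iff power_one_right
    using prime_card assms by (rule binomial_gram_prime_cong)
  also have "padic_cong 1 \<dots> (if j + k = CARD('p) - 1 then (- 1) ^ j else 0)"
    using binomial_card_minus_one_padic_cong[of j, where 'p = 'p] assms by simp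
  finally show ?thesis .
qed

lemma mult_binomial_gram_padic_cong:
  fixes a b :: "'p::prime_card padic"
  assumes "u + v < CARD('p)" and integral: "a \<in> padic_Ints" "b \<in> padic_Ints"
    and "u < j \<Longrightarrow> padic_cong 1 a 0" and "v < k \<Longrightarrow> padic_cong 1 b 0"
  shows "padic_cong 1 (a * b * of_nat (binomial_gram CARD('p) j k))
    (if j = u \<and> k = v \<and> u + v = CARD('p) - 1 then (- 1) ^ u * a * b else 0)"
proof -
  consider (above_u) "u < j" | (above_v) "v < k" | (below) "j \<le> u" "k \<le> v"
    by linarith
  then show ?thesis
  proof cases
    case above_u
    then have "padic_cong 1 (a * (b * of_nat (binomial_gram CARD('p) j k))) 0"
      using assms by (intro padic_cong_mult_0) simp_all
    with above_u show ?thesis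
      by (simp add: mult.assoc)
  next
    case above_v
    then have "padic_cong 1 (b * (a * of_nat (binomial_gram CARD('p) j k))) 0"
      using assms by (intro padic_cong_mult_0) simp_all
    with above_v show ?thesis
      by (simp add: mult_ac)
  next
    case below
    then have "padic_cong 1 (a * b * of_nat (binomial_gram CARD('p) j k))
        (a * b * (if j + k = CARD('p) - 1 then (- 1) ^ j else 0))"
      using assms(1) integral
      by (intro padic_cong_mult padic_cong_refl binomial_gram_padic_cong) simp_all
    moreover have "j + k = CARD('p) - 1 \<longleftrightarrow> j = u \<and> k = v \<and> u + v = CARD('p) - 1"
      using below assms(1) by linarith
    ultimately show ?thesis
      by (auto simp: mult_ac)
  qed
qed

lemma sum_binomial_transform_mult_padic_cong:
  fixes a b :: "nat \<Rightarrow> 'p::prime_card padic"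
  assumes degrees: "u + v < CARD('p)"
    and integral: "\<And>j. a j \<in> padic_Ints" "\<And>k. b k \<in> padic_Ints"
    and vanish: "\<And>j. u < j \<Longrightarrow> j < CARD('p) \<Longrightarrow> padic_cong 1 (a j) 0"
      "\<And>k. v < k \<Longrightarrow> k < CARD('p) \<Longrightarrow> padic_cong 1 (b k) 0"
  shows "padic_cong 1 (\<Sum>n<CARD('p). binomial_transform a n * binomial_transform b n)
    (if u + v = CARD('p) - 1 then (- 1) ^ u * a u * b v else 0)"
proof -
  have "padic_cong 1 (\<Sum>n<CARD('p). binomial_transform a n * binomial_transform b n)
      (\<Sum>j<CARD('p). \<Sum>k<CARD('p).
        if j = u \<and> k = v \<and> u + v = CARD('p) - 1 then (- 1) ^ u * a j * b k else 0)"
    unfolding sum_binomial_transform_mult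
    by (intro padic_cong_sum mult_binomial_gram_padic_cong degrees integral vanish) simp_all
  also have "\<dots> = (\<Sum>j<CARD('p). \<Sum>k<CARD('p). if k = v then if j = u then
        if u + v = CARD('p) - 1 then (- 1) ^ u * a u * b v else 0 else 0 else 0)"
    by (intro sum.cong refl) simp
  also have "\<dots> = (if u + v = CARD('p) - 1 then (- 1) ^ u * a u * b v else 0)"
    using degrees by simp
  finally show ?thesis .
qed

section \<open>The two families of polynomials\<close>

lemma D_coeff_in_padic_Ints: "x \<in> padic_Ints \<Longrightarrow> y \<in> padic_Ints \<Longrightarrow> D_coeff x y k \<in> padic_Ints"
  by (simp add: D_coeff_def gbinomial_in_padic_Ints)

lemma S_coeff_in_padic_Ints: "x \<in> padic_Ints \<Longrightarrow> y \<in> padic_Ints \<Longrightarrow> S_coeff x y k \<in> padic_Ints"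
  by (simp add: S_coeff_def gbinomial_in_padic_Ints)

lemma D_coeff_padic_cong_0:
  fixes x y :: "'p::prime_card padic"
  assumes "least_residue x < k" and "k < CARD('p)" and "x \<in> padic_Ints" and "y \<in> padic_Ints"
  shows "padic_cong 1 (D_coeff x y k) 0"
  unfolding D_coeff_def using assms by (intro padic_cong_mult_0 gbinomial_padic_cong_0) simp_all

lemma S_coeff_padic_cong_0:
  fixes x y :: "'p::prime_card padic"
  assumes "min (least_residue x) (least_residue (- 1 - x)) < k" and "k < CARD('p)"
    and "x \<in> padic_Ints" and "y \<in> padic_Ints"
  shows "padic_cong 1 (S_coeff x y k) 0"
proof (cases "least_residue x < k")
  case True
  then have "padic_cong 1 (D_coeff x y k * ((- 1 - x) gchoose k)) 0"
    using assms by (intro padic_cong_mult_0 D_coeff_padic_cong_0 gbinomial_in_padic_Ints) simp_all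
  then show ?thesis
    by (simp only: S_coeff_def D_coeff_def mult_ac)
next
  case False
  then have "padic_cong 1 (D_coeff (- 1 - x) y k * (x gchoose k)) 0"
    using assms by (intro padic_cong_mult_0 D_coeff_padic_cong_0 gbinomial_in_padic_Ints) simp_all
  then show ?thesis
    by (simp only: S_coeff_def D_coeff_def mult_ac)
qed

lemma D_coeff_mult_least_residues_padic_cong_1:
  fixes x y :: "'p::prime_card padic"
  assumes "x \<in> padic_Ints" and "y \<in> padic_Ints" and "\<not> padic_cong 1 y 0"
  shows "padic_cong 1
    (D_coeff x y (least_residue x) * D_coeff (- 1 - x) y (least_residue (- 1 - x))) 1"
proof -
  let ?r = "least_residue x" and ?s = "least_residue (- 1 - x)"
  have "D_coeff x y ?r * D_coeff (- 1 - x) y ?s =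
      (x gchoose ?r) * ((- 1 - x) gchoose ?s) * y ^ (CARD('p) - 1)"
    unfolding least_residue_add_least_residue[OF assms(1), symmetric]
    by (simp only: D_coeff_def power_add mult_ac)
  also have "padic_cong 1 \<dots> (1 * 1 * 1)"
    using assms by (intro padic_cong_mult gbinomial_least_residue_padic_cong_1
        padic_power_card_minus_one_cong) (simp_all add: gbinomial_in_padic_Ints)
  finally show ?thesis
    by simp
qed

lemma S_coeff_square_padic_cong_1:
  fixes x y :: "'p::prime_card padic"
  assumes "x \<in> padic_Ints" and "y \<in> padic_Ints" and "\<not> padic_cong 1 y 0"
    and "least_residue (- 1 - x) = least_residue x"
  shows "padic_cong 1 ((S_coeff x y (least_residue x))\<^sup>2) 1"
proof -
  let ?r = "least_residue x"
  have "(S_coeff x y ?r)\<^sup>2 =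
      (D_coeff x y ?r * D_coeff (- 1 - x) y ?r) * ((x gchoose ?r) * ((- 1 - x) gchoose ?r))"
    by (simp only: S_coeff_def D_coeff_def power2_eq_square mult_ac)
  also have "padic_cong 1 \<dots> (1 * (1 * 1))"
    using assms D_coeff_mult_least_residues_padic_cong_1[OF assms(1-3)]
      gbinomial_least_residue_padic_cong_1[of "- 1 - x"]
    by (intro padic_cong_mult gbinomial_least_residue_padic_cong_1)
      (simp_all add: gbinomial_in_padic_Ints D_coeff_in_padic_Ints)
  finally show ?thesis
    by simp
qed

lemma sum_D_poly_mult_padic_cong:
  fixes x y :: "'p::prime_card padic"
  assumes "x \<in> padic_Ints" and "y \<in> padic_Ints" and "\<not> padic_cong 1 y 0"
  shows "padic_cong 1 (\<Sum>k<CARD('p). D_poly k x y * D_poly k (- 1 - x) y)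
    ((- 1) ^ least_residue x)"
proof -
  let ?r = "least_residue x" and ?s = "least_residue (- 1 - x)"
  have "?r + ?s = CARD('p) - 1"
    using assms(1) by (rule least_residue_add_least_residue)
  moreover have "?r + ?s < CARD('p)"
    using calculation zero_less_card_finite[where 'a = 'p] by linarith
  then have "padic_cong 1 (\<Sum>k<CARD('p). D_poly k x y * D_poly k (- 1 - x) y)
      (if ?r + ?s = CARD('p) - 1 then (- 1) ^ ?r * D_coeff x y ?r * D_coeff (- 1 - x) y ?s else 0)"
    unfolding D_poly_eq_binomial_transform using assms(1,2)
    by (intro sum_binomial_transform_mult_padic_cong D_coeff_padic_cong_0 D_coeff_in_padic_Ints)
      simp_all
  ultimately have "padic_cong 1 (\<Sum>k<CARD('p). D_poly k x y * D_poly k (- 1 - x) y)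
      ((- 1) ^ ?r * (D_coeff x y ?r * D_coeff (- 1 - x) y ?s))"
    by (simp only: if_True simp_thms mult.assoc)
  also have "padic_cong 1 \<dots> ((- 1) ^ ?r * 1)"
    using assms by (intro padic_cong_mult padic_cong_refl D_coeff_mult_least_residues_padic_cong_1)
      simp_all
  finally show ?thesis
    by simp
qed

lemma Legendre_minus_one_padic_cong:
  assumes "CARD('p) \<noteq> 2"
  shows "padic_cong 1 ((- 1) ^ ((CARD('p) - 1) div 2))
    (of_int (Legendre (- 1) (int CARD('p))) :: 'p::prime_card padic)"
proof -
  have "CARD('p) > 2"
    using assms prime_ge_2_nat[OF prime_card[where 'a = 'p]] by simp
  then have "[(- 1) ^ ((CARD('p) - 1) div 2) = Legendre (- 1) (int CARD('p))] (mod int CARD('p))"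
    by (intro cong_sym[OF euler_criterion] prime_card)
  then have "padic_cong 1 (of_int ((- 1) ^ ((CARD('p) - 1) div 2)))
      (of_int (Legendre (- 1) (int CARD('p))) :: 'p padic)"
    by (simp only: padic_cong_of_int_iff power_one_right)
  then show ?thesis
    by simp
qed

lemma sum_S_poly_square_padic_cong:
  fixes x y :: "'p::prime_card padic"
  assumes "x \<in> padic_Ints" and "y \<in> padic_Ints" and "\<not> padic_cong 1 y 0" and "CARD('p) \<noteq> 2"
  shows "padic_cong 1 (\<Sum>k<CARD('p). (S_poly k x y)\<^sup>2)
    (if padic_cong 1 x (- 1 / 2) then of_int (Legendre (- 1) (int CARD('p))) else 0)"
proof -
  let ?r = "least_residue x" and ?s = "least_residue (- 1 - x)"
  let ?m = "min ?r ?s"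
  have residues_add: "?r + ?s = CARD('p) - 1"
    using assms(1) by (rule least_residue_add_least_residue)
  then have twice_min: "?m + ?m < CARD('p)" "?m + ?m = CARD('p) - 1 \<longleftrightarrow> ?r = ?s"
    using zero_less_card_finite[where 'a = 'p] by linarith+
  have half_iff: "padic_cong 1 x (- 1 / 2) \<longleftrightarrow> ?r = ?s"
    unfolding padic_cong_minus_half_iff[OF assms(4)] using assms(1)
    by (intro least_residue_eq_iff[symmetric]) simp_all
  have sum_cong: "padic_cong 1 (\<Sum>k<CARD('p). (S_poly k x y)\<^sup>2)
      (if ?m + ?m = CARD('p) - 1 then (- 1) ^ ?m * S_coeff x y ?m * S_coeff x y ?m else 0)"
    unfolding S_poly_eq_binomial_transform power2_eq_square using assms(1,2) twice_min(1)
    by (intro sum_binomial_transform_mult_padic_cong S_coeff_padic_cong_0 S_coeff_in_padic_Ints)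
  show ?thesis
  proof (cases "?r = ?s")
    case True
    with residues_add have r_eq: "(CARD('p) - 1) div 2 = ?r"
      by simp
    have "padic_cong 1 (\<Sum>k<CARD('p). (S_poly k x y)\<^sup>2) ((- 1) ^ ?r * (S_coeff x y ?r)\<^sup>2)"
      using sum_cong twice_min(2) True by (simp add: power2_eq_square mult.assoc)
    also have "padic_cong 1 \<dots> ((- 1) ^ ?r * 1)"
      using assms True
      by (intro padic_cong_mult padic_cong_refl S_coeff_square_padic_cong_1) simp_all
    also have "padic_cong 1 \<dots> (of_int (Legendre (- 1) (int CARD('p))))"
      using Legendre_minus_one_padic_cong[OF assms(4)] by (simp only: r_eq mult_1_right)
    finally show ?thesis
      using half_iff True by simp
  next
    case False
    then show ?thesis
      using sum_cong twice_min(2) half_iff by simp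
  qed
qed

theorem theorem1p1:
  fixes x y :: "'p::prime_card padic"
  assumes "x \<in> padic_Ints" and "y \<in> padic_Ints" and "\<not> padic_cong 1 y 0"
  shows "padic_cong 1
           (\<Sum>k=0..CARD('p) - 1. D_poly k x y * D_poly k (- 1 - x) y)
           ((- 1) ^ least_residue x)
       \<and> (\<not> padic_cong 1 y 1 \<longrightarrow>
           padic_cong 1
             (\<Sum>k=0..CARD('p) - 1. (1 - y) ^ k * D_poly k x y * D_poly k x (y / (y - 1)))
             ((- 1) ^ least_residue x))
       \<and> (CARD('p) \<noteq> 2 \<longrightarrow>
           padic_cong 1
             (\<Sum>k=0..CARD('p) - 1. (S_poly k x y)\<^sup>2)
             (if padic_cong 1 x (- 1 / 2) then of_int (Legendre (- 1) (int CARD('p))) else 0))"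
proof -
  have range: "{0..CARD('p) - 1} = {..<CARD('p)}"
    using lessThan_Suc_atMost[of "CARD('p) - 1"] by (simp add: atMost_atLeast0)
  have Pfaff: "(1 - y) ^ k * D_poly k x y * D_poly k x (y / (y - 1)) =
      D_poly k x y * D_poly k (- 1 - x) y" if "\<not> padic_cong 1 y 1" for k
  proof -
    have "y \<noteq> 1"
      using that by auto
    then show ?thesis
      by (simp only: mult.assoc mult.left_commute[of "(1 - y) ^ k"] D_poly_Pfaff not_False_eq_True)
  qed
  show ?thesis
    unfolding range
  proof (intro conjI impI)
    show first: "padic_cong 1 (\<Sum>k<CARD('p). D_poly k x y * D_poly k (- 1 - x) y)
        ((- 1) ^ least_residue x)"
      using assms by (rule sum_D_poly_mult_padic_cong)
    show "padic_cong 1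
        (\<Sum>k<CARD('p). (1 - y) ^ k * D_poly k x y * D_poly k x (y / (y - 1)))
        ((- 1) ^ least_residue x)" if "\<not> padic_cong 1 y 1"
      unfolding Pfaff[OF that] by (rule first)
  qed (rule sum_S_poly_square_padic_cong[OF assms])
qed

end
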